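(* Let $\mu\in\mathcal{P}(\mathcal{X})$, let $I,J\subseteq\{1,\dots,K\}$ be disjoint and non-empty, and let $a>0$, $M\ge 0$. Assume that $\mu_{I,J}$ has a Lebesgue density $f_{I,J}=\frac{d\mu_{I,J}}{dx_{I,J}}$ and set $f_I=\frac{d\mu_I}{dx_I}$ and $f_J=\frac{d\mu_J}{dx_J}$. If $f_J\ge a$ and $\mathcal{X}_J\ni x_J\mapsto f_{I,J}(\cdot,x_J)\in L^1(dx_I)$ is $M$-Lipschitz, then $x_J\mapsto\mu(dx_I\mid x_J)$ is $M/a$-Lipschitz with respect to total variation. Consequently, if $\mu\in\mathcal{P}_G$ and if (with the same $a$ and $M$), for every $k=2,\dots,K$ and for all those of the pairs $(I,J)=(\{k\},\mathrm{pa}(k))$, $(I,J)=(\mathrm{pre}(k),\mathrm{pa}(k))$, $(I,J)=(\mathrm{pa}(k),\{k\})$ in which both $I$ and $J$ are non-empty, the marginal $\mu_{I,J}$ has a Lebesgue density $f_{I,J}$, the density $f_J$ of $\mu_J$ satisfies $f_J\ge a$, and $\mathcal{X}_J\ni x_J\mapsto f_{I,J}(\cdot,x_J)\in L^1(dx_I)$ is $M$-Lipschitz, then $\mu$ satisfies the TV-Lipschitz condition with constant $M/a$ (see context).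
   Context: $G$ is a directed acyclic graph with nodes $\{1,\dots,K\}$, topologically sorted (every edge $i\to j$ has $i<j$); $\mathrm{pa}(k)$ is the set of parents of $k$ and $\mathrm{pre}(k)=\{1,\dots,k-1\}\setminus\mathrm{pa}(k)$. $\mathcal{X}=\mathcal{X}_1\times\dots\times\mathcal{X}_K$ with $\mathcal{X}_k=[0,1]^{d_k}$, $\mathcal{X}_I=\prod_{i\in I}\mathcal{X}_i$, $x_I=(x_i)_{i\in I}$. $\mathcal{P}(\mathcal{X})$ is the set of Borel probability measures on $\mathcal{X}$. $\|\cdot\|$ is the sup-norm. $\mu_I,\mu_J,\mu_{I,J}$ are the marginals of $\mu$ on $\mathcal{X}_I,\mathcal{X}_J,\mathcal{X}_{I}\times\mathcal{X}_J$. $\mathcal{P}_G$ is the set of Borel probability measures $\mu$ on $\mathcal{X}$ with $\mu(dx)=\prod_{k=1}^K\mu(dx_k\mid x_{\mathrm{pa}(k)})$ (regular conditional distributions; marginal if $\mathrm{pa}(k)=\emptyset$). $\mathrm{TV}(\nu,\tilde\nu)=\sup_f(\int f\,d\nu-\int f\,d\tilde\nu)$ over measurable $|f|\le1/2$. Statements about kernels $x_J\mapsto\mu(dx_I\mid x_J)$ and densities refer to suitable versions. TV-Lipschitz condition with constant $L$ for $\mu\in\mathcal{P}_G$: for all $2\le k\le K$, all $x_{\mathrm{pa}(k)},\tilde x_{\mathrm{pa}(k)}\in\mathcal{X}_{\mathrm{pa}(k)}$ and all $x_k,\tilde x_k\in\mathcal{X}_k$: $\mathrm{TV}(\mu(dx_k\mid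 x_{\mathrm{pa}(k)}),\mu(dx_k\mid\tilde x_{\mathrm{pa}(k)}))\le L\|x_{\mathrm{pa}(k)}-\tilde x_{\mathrm{pa}(k)}\|$; $\mathrm{TV}(\mu(dx_{\mathrm{pre}(k)}\mid x_{\mathrm{pa}(k)}),\mu(dx_{\mathrm{pre}(k)}\mid\tilde x_{\mathrm{pa}(k)}))\le L\|x_{\mathrm{pa}(k)}-\tilde x_{\mathrm{pa}(k)}\|$; $\mathrm{TV}(\mu(dx_{\mathrm{pa}(k)}\mid x_k),\mu(dx_{\mathrm{pa}(k)}\mid\tilde x_k))\le L\|x_k-\tilde x_k\|$ (conditions involving empty index sets are void). *)

theory Defs
  imports "HOL-Probability.Probability"
begin

(* Points of X_I are extensional functions x :: nat => nat => real, with x k i the i-th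
   coordinate (i < d k) of the component x_k.  cube d I is X_I with Lebesgue measure dx_I;
   it also supplies the Borel sigma-algebra of X_I.  X_{} is a one-point space, and X_k is
   identified with X_{{k}}. *)
definition cube :: "(nat \<Rightarrow> nat) \<Rightarrow> nat set \<Rightarrow> (nat \<Rightarrow> nat \<Rightarrow> real) measure" where
  "cube d I = (\<Pi>\<^sub>M k\<in>I. \<Pi>\<^sub>M i\<in>{..<d k}. restrict_space lborel {0..1})"

(* The added 0 only matters if there are no coordinates at all. *)
definition supnorm :: "(nat \<Rightarrow> nat) \<Rightarrow> nat set \<Rightarrow> (nat \<Rightarrow> nat \<Rightarrow> real) \<Rightarrow> real" where
  "supnorm d I z = Max (insert 0 ((\<lambda>(k, i). \<bar>z k i\<bar>) ` (SIGMA k:I. {..<d k})))"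

definition supdist ::
    "(nat \<Rightarrow> nat) \<Rightarrow> nat set \<Rightarrow> (nat \<Rightarrow> nat \<Rightarrow> real) \<Rightarrow> (nat \<Rightarrow> nat \<Rightarrow> real) \<Rightarrow> real" where
  "supdist d I x y = supnorm d I (\<lambda>k i. x k i - y k i)"

definition marginal ::
    "(nat \<Rightarrow> nat) \<Rightarrow> (nat \<Rightarrow> nat \<Rightarrow> real) measure \<Rightarrow> nat set \<Rightarrow> (nat \<Rightarrow> nat \<Rightarrow> real) measure" where
  "marginal d \<mu> I = distr \<mu> (cube d I) (\<lambda>x. restrict x I)"

definition marginal2 ::
    "(nat \<Rightarrow> nat) \<Rightarrow> (nat \<Rightarrow> nat \<Rightarrow> real) measure \<Rightarrow> nat set \<Rightarrow> nat set \<Rightarrow>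
      ((nat \<Rightarrow> nat \<Rightarrow> real) \<times> (nat \<Rightarrow> nat \<Rightarrow> real)) measure" where
  "marginal2 d \<mu> I J =
    distr \<mu> (cube d I \<Otimes>\<^sub>M cube d J) (\<lambda>x. (restrict x I, restrict x J))"

definition is_density :: "'a measure \<Rightarrow> 'a measure \<Rightarrow> ('a \<Rightarrow> real) \<Rightarrow> bool" where
  "is_density N \<nu> f \<longleftrightarrow>
    f \<in> borel_measurable N \<and> (\<forall>x\<in>space N. 0 \<le> f x) \<and> \<nu> = density N (\<lambda>x. ennreal (f x))"

(* Intended for probability measures with the same sigma-algebra; the supremum is then over a
   nonempty bounded set. *)
definition TV :: "'a measure \<Rightarrow> 'a measure \<Rightarrow> real" where
  "TV \<nu> \<nu>' = (SUP f\<in>{f \<in> borel_measurable \<nu>. \<forall>x\<in>space \<nu>. \<bar>f x\<bar> \<le> (1/2::real)}.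
     (\<integral>x. f x \<partial>\<nu>) - (\<integral>x. f x \<partial>\<nu>'))"

(* kappa is a version of the regular conditional distribution mu(dx_I | x_J). *)
definition is_cond_distr ::
    "(nat \<Rightarrow> nat) \<Rightarrow> (nat \<Rightarrow> nat \<Rightarrow> real) measure \<Rightarrow> nat set \<Rightarrow> nat set \<Rightarrow>
      ((nat \<Rightarrow> nat \<Rightarrow> real) \<Rightarrow> (nat \<Rightarrow> nat \<Rightarrow> real) measure) \<Rightarrow> bool" where
  "is_cond_distr d \<mu> I J \<kappa> \<longleftrightarrow>
    \<kappa> \<in> cube d J \<rightarrow>\<^sub>M prob_algebra (cube d I) \<and>
    (\<forall>A\<in>sets (cube d I). \<forall>B\<in>sets (cube d J).
      emeasure (marginal2 d \<mu> I J) (A \<times> B) =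
        (\<integral>\<^sup>+x\<in>B. emeasure (\<kappa> x) A \<partial>marginal d \<mu> J))"

definition TV_lipschitz_kernel ::
    "(nat \<Rightarrow> nat) \<Rightarrow> (nat \<Rightarrow> nat \<Rightarrow> real) measure \<Rightarrow> nat set \<Rightarrow> nat set \<Rightarrow> real \<Rightarrow> bool" where
  "TV_lipschitz_kernel d \<mu> I J L \<longleftrightarrow>
    (\<exists>\<kappa>. is_cond_distr d \<mu> I J \<kappa> \<and>
      (\<forall>x\<in>space (cube d J). \<forall>y\<in>space (cube d J). TV (\<kappa> x) (\<kappa> y) \<le> L * supdist d J x y))"

(* x_J |-> f(., x_J) takes values in L^1(dx_I) and is M-Lipschitz. *)
definition L1_lipschitz ::
    "(nat \<Rightarrow> nat) \<Rightarrow> nat set \<Rightarrow> nat set \<Rightarrow> real \<Rightarrow>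
      ((nat \<Rightarrow> nat \<Rightarrow> real) \<times> (nat \<Rightarrow> nat \<Rightarrow> real) \<Rightarrow> real) \<Rightarrow> bool" where
  "L1_lipschitz d I J M f \<longleftrightarrow>
    (\<forall>x\<in>space (cube d J). integrable (cube d I) (\<lambda>z. f (z, x))) \<and>
    (\<forall>x\<in>space (cube d J). \<forall>y\<in>space (cube d J).
      (\<integral>z. \<bar>f (z, x) - f (z, y)\<bar> \<partial>cube d I) \<le> M * supdist d J x y)"

(* The versions of the densities are existentially quantified; f_J \<ge> a is required
   almost everywhere, so it does not depend on the version of f_J. *)
definition lipschitz_density ::
    "(nat \<Rightarrow> nat) \<Rightarrow> (nat \<Rightarrow> nat \<Rightarrow> real) measure \<Rightarrow> nat set \<Rightarrow> nat set \<Rightarrow> real \<Rightarrow> real \<Rightarrow> bool" where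
  "lipschitz_density d \<mu> I J a M \<longleftrightarrow>
    (\<exists>f f\<^sub>J. is_density (cube d I \<Otimes>\<^sub>M cube d J) (marginal2 d \<mu> I J) f \<and>
      is_density (cube d J) (marginal d \<mu> J) f\<^sub>J \<and>
      (AE x in cube d J. a \<le> f\<^sub>J x) \<and>
      L1_lipschitz d I J M f)"

definition sorted_dag :: "nat \<Rightarrow> (nat \<times> nat) set \<Rightarrow> bool" where
  "sorted_dag K E \<longleftrightarrow> E \<subseteq> {1..K} \<times> {1..K} \<and> acyclic E \<and> (\<forall>(i, j)\<in>E. i < j)"

definition pa :: "(nat \<times> nat) set \<Rightarrow> nat \<Rightarrow> nat set" where
  "pa E k = {i. (i, k) \<in> E}"

definition pre :: "(nat \<times> nat) set \<Rightarrow> nat \<Rightarrow> nat set" where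
  "pre E k = {1..<k} - pa E k"

(* The measure kappa_1(dx_1 | x_pa(1)) ... kappa_n(dx_n | x_pa(n)) on X_{1..n}. *)
primrec kernel_product ::
    "(nat \<Rightarrow> nat) \<Rightarrow> (nat \<times> nat) set \<Rightarrow>
      (nat \<Rightarrow> (nat \<Rightarrow> nat \<Rightarrow> real) \<Rightarrow> (nat \<Rightarrow> nat \<Rightarrow> real) measure) \<Rightarrow> nat \<Rightarrow>
      (nat \<Rightarrow> nat \<Rightarrow> real) measure" where
  "kernel_product d E \<kappa> 0 = return (cube d {}) (\<lambda>_. undefined)"
| "kernel_product d E \<kappa> (Suc n) =
    kernel_product d E \<kappa> n \<bind> (\<lambda>x. \<kappa> (Suc n) (restrict x (pa E (Suc n))) \<bind>
      (\<lambda>y. return (cube d {1..Suc n}) (merge {1..n} {Suc n} (x, y))))"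

definition P_G ::
    "(nat \<Rightarrow> nat) \<Rightarrow> nat \<Rightarrow> (nat \<times> nat) set \<Rightarrow> (nat \<Rightarrow> nat \<Rightarrow> real) measure set" where
  "P_G d K E = {\<mu> \<in> space (prob_algebra (cube d {1..K})).
    \<exists>\<kappa>. (\<forall>k\<in>{1..K}. is_cond_distr d \<mu> {k} (pa E k) (\<kappa> k)) \<and> \<mu> = kernel_product d E \<kappa> K}"

definition dag_pairs :: "(nat \<times> nat) set \<Rightarrow> nat \<Rightarrow> (nat set \<times> nat set) set" where
  "dag_pairs E k = {(I, J) \<in> {({k}, pa E k), (pre E k, pa E k), (pa E k, {k})}. I \<noteq> {} \<and> J \<noteq> {}}"

definition TV_lipschitz_condition ::
    "(nat \<Rightarrow> nat) \<Rightarrow> nat \<Rightarrow> (nat \<times> nat) set \<Rightarrow> (nat \<Rightarrow> nat \<Rightarrow> real) measure \<Rightarrow> real \<Rightarrow> bool" where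
  "TV_lipschitz_condition d K E \<mu> L \<longleftrightarrow>
    (\<forall>k\<in>{2..K}. \<forall>(I, J)\<in>dag_pairs E k. TV_lipschitz_kernel d \<mu> I J L)"

end

theory Submission
  imports Defs
begin

text \<open>
  Choose the kernel \<open>x \<mapsto> f(z, x) / g x dz\<close> with \<open>g x = \<integral> f(z, x) dz\<close>. The function \<open>g\<close> is a
  version of the density of the marginal on the conditioning variables and inherits the Lipschitz
  property of \<open>f\<close>, so it is continuous; as Lebesgue measure on a cube charges every sup-norm
  ball, the almost sure bound \<open>g \<ge> a\<close> holds at every point. The total variation distance of
  two kernels is half the \<open>L\<^sup>1\<close>-distance of their densities, and normalising two nonnegative functions
  by their integrals (at least \<open>a\<close>) increases their \<open>L\<^sup>1\<close>-distance by at most the factor \<open>2 / a\<close>.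
\<close>

section \<open>Total variation and L^1 distances\<close>

text \<open>For a test function \<open>h\<close> with values in [-1/2, 1/2], the difference of the
  two integrals is the integral of \<open>(p - q) * h\<close>, and this integrand is at most half of
  \<open>\<bar>p - q\<bar>\<close>.\<close>

lemma TV_density_le:
  fixes p q :: "'a \<Rightarrow> real"
  assumes p: "integrable N p" "\<And>x. x \<in> space N \<Longrightarrow> 0 \<le> p x"
    and q: "integrable N q" "\<And>x. x \<in> space N \<Longrightarrow> 0 \<le> q x"
  shows "TV (density N (\<lambda>x. ennreal (p x))) (density N (\<lambda>x. ennreal (q x)))
    \<le> (\<integral>x. \<bar>p x - q x\<bar> \<partial>N) / 2"
  unfolding TV_def
proof (rule cSUP_least)
  show "{h \<in> borel_measurable (density N (\<lambda>x. ennreal (p x))).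
      \<forall>x\<in>space (density N (\<lambda>x. ennreal (p x))). \<bar>h x\<bar> \<le> (1/2::real)} \<noteq> {}"
    \<comment> \<open>The supremum is taken in the reals, so bounding it requires a nonempty set of
      test functions; the zero function is one.\<close>
    by (auto intro!: exI[of _ "\<lambda>_. 0"])
next
  fix h :: "'a \<Rightarrow> real"
  assume "h \<in> {h \<in> borel_measurable (density N (\<lambda>x. ennreal (p x))).
      \<forall>x\<in>space (density N (\<lambda>x. ennreal (p x))). \<bar>h x\<bar> \<le> 1/2}"
  then have [measurable]: "h \<in> borel_measurable N" and h: "\<And>x. x \<in> space N \<Longrightarrow> \<bar>h x\<bar> \<le> 1/2"
    by auto
  have [measurable]: "p \<in> borel_measurable N" "q \<in> borel_measurable N"
    using p q by auto
  have int: "integrable N (\<lambda>x. u x * h x)" if "integrable N u" for u :: "'a \<Rightarrow> real"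
  proof (rule Bochner_Integration.integrable_bound[OF that])
    show "(\<lambda>x. u x * h x) \<in> borel_measurable N" using that by measurable
    show "AE x in N. norm (u x * h x) \<le> norm (u x)"
    proof (intro AE_I2)
      fix x assume "x \<in> space N"
      then have "\<bar>h x\<bar> \<le> 1" using h by force
      then show "norm (u x * h x) \<le> norm (u x)"
        by (simp add: abs_mult mult_left_le)
    qed
  qed
  have "(\<integral>x. h x \<partial>density N (\<lambda>x. ennreal (p x))) - (\<integral>x. h x \<partial>density N (\<lambda>x. ennreal (q x)))
      = (\<integral>x. p x * h x \<partial>N) - (\<integral>x. q x * h x \<partial>N)"
    using p(2) q(2) by (subst (1 2) integral_density) auto
  also have "\<dots> = (\<integral>x. p x * h x - q x * h x \<partial>N)"
    using int p(1) q(1) by simp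
  also have "\<dots> \<le> (\<integral>x. \<bar>p x - q x\<bar> / 2 \<partial>N)"
  proof (rule integral_mono)
    fix x assume "x \<in> space N"
    have "(p x - q x) * h x \<le> \<bar>p x - q x\<bar> * \<bar>h x\<bar>"
      by (metis abs_ge_self abs_mult)
    also have "\<dots> \<le> \<bar>p x - q x\<bar> * (1/2)"
      using h[OF \<open>x \<in> space N\<close>] by (intro mult_left_mono) auto
    finally show "p x * h x - q x * h x \<le> \<bar>p x - q x\<bar> / 2"
      by (simp add: algebra_simps)
  qed (use int p q in auto)
  also have "\<dots> = (\<integral>x. \<bar>p x - q x\<bar> \<partial>N) / 2"
    by simp
  finally show "(\<integral>x. h x \<partial>density N (\<lambda>x. ennreal (p x)))
      - (\<integral>x. h x \<partial>density N (\<lambda>x. ennreal (q x))) \<le> (\<integral>x. \<bar>p x - q x\<bar> \<partial>N) / 2" .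
qed

text \<open>Integration is a contraction on L^1. This compares the two normalising constants below
  and later gives the Lipschitz bound for the marginal density.\<close>

lemma abs_integral_diff_le:
  fixes u v :: "'a \<Rightarrow> real"
  assumes "integrable N u" "integrable N v"
  shows "\<bar>(\<integral>x. u x \<partial>N) - (\<integral>x. v x \<partial>N)\<bar> \<le> (\<integral>x. \<bar>u x - v x\<bar> \<partial>N)"
  using integral_abs_bound[of N "\<lambda>x. u x - v x"] assms by simp

text \<open>Write \<open>u / U - v / V\<close> as \<open>(u - v) / U\<close> plus
  \<open>v * (1 / U - 1 / V)\<close>. The first term has L^1 norm \<open>D / U\<close>. In the
  second the mass \<open>V\<close> of \<open>v\<close> cancels and leaves
  \<open>\<bar>U - V\<bar> / U\<close>, which is again at most \<open>D / U\<close>. The splitting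
  is asymmetric, so the bound \<open>a\<close> enters only through \<open>U\<close>.\<close>

lemma L1_dist_normalized_le:
  fixes u v :: "'a \<Rightarrow> real"
  assumes u: "integrable N u" and v: "integrable N v" "\<And>x. x \<in> space N \<Longrightarrow> 0 \<le> v x"
    and a: "0 < a" "a \<le> (\<integral>x. u x \<partial>N)" and pos: "0 < (\<integral>x. v x \<partial>N)"
  shows "(\<integral>x. \<bar>u x / (\<integral>x. u x \<partial>N) - v x / (\<integral>x. v x \<partial>N)\<bar> \<partial>N)
    \<le> 2 * (\<integral>x. \<bar>u x - v x\<bar> \<partial>N) / a"
proof -
  define U where "U = (\<integral>x. u x \<partial>N)"
  define V where "V = (\<integral>x. v x \<partial>N)"
  define D where "D = (\<integral>x. \<bar>u x - v x\<bar> \<partial>N)"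
  have U: "0 < U" "a \<le> U" and V: "0 < V" using a pos by (auto simp: U_def V_def)
  have D: "\<bar>U - V\<bar> \<le> D" unfolding U_def V_def D_def by (rule abs_integral_diff_le[OF u v(1)])
  have "(\<integral>x. \<bar>u x / U - v x / V\<bar> \<partial>N)
      \<le> (\<integral>x. \<bar>u x - v x\<bar> / U + v x * (\<bar>U - V\<bar> / (U * V)) \<partial>N)"
  proof (rule integral_mono)
    fix x assume x: "x \<in> space N"
    have "u x / U - v x / V = (u x - v x) / U + v x * ((V - U) / (U * V))"
      using U V by (simp add: field_simps)
    also have "\<bar>\<dots>\<bar> \<le> \<bar>(u x - v x) / U\<bar> + \<bar>v x * ((V - U) / (U * V))\<bar>"
      by (rule abs_triangle_ineq)
    also have "\<dots> = \<bar>u x - v x\<bar> / U + v x * (\<bar>U - V\<bar> / (U * V))"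
      using U V v(2)[OF x] by (simp add: abs_mult abs_minus_commute)
    finally show "\<bar>u x / U - v x / V\<bar> \<le> \<bar>u x - v x\<bar> / U + v x * (\<bar>U - V\<bar> / (U * V))" .
  qed (use u v in auto)
  also have "\<dots> = D / U + V * (\<bar>U - V\<bar> / (U * V))"
    using u v by (simp add: D_def V_def)
  also have "\<dots> = (D + \<bar>U - V\<bar>) / U"
    using U V by (simp add: field_simps)
  also have "\<dots> \<le> 2 * D / a"
    using D U a by (intro frac_le) auto
  finally show ?thesis by (simp add: U_def V_def D_def)
qed

section \<open>Lebesgue measure on the cubes and sup-norm balls\<close>

lemma prob_space_unit_interval: "prob_space (restrict_space lborel {0..1::real})"
  by (rule prob_spaceI) (simp add: space_restrict_space emeasure_restrict_space)

lemma prob_space_cube: "prob_space (cube d I)"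
  unfolding cube_def by (intro prob_space_PiM prob_space_unit_interval)

lemma space_cube: "space (cube d I) = (\<Pi>\<^sub>E k\<in>I. \<Pi>\<^sub>E i\<in>{..<d k}. {0..1})"
  by (simp add: cube_def space_PiM space_restrict_space)

lemma measurable_restrict_cube:
  assumes "J \<subseteq> I"
  shows "(\<lambda>x. restrict x J) \<in> cube d I \<rightarrow>\<^sub>M cube d J"
  unfolding cube_def using assms by (rule measurable_restrict_subset)

lemma supnorm_le:
  assumes "finite I" "0 \<le> r" "\<And>k i. k \<in> I \<Longrightarrow> i < d k \<Longrightarrow> \<bar>z k i\<bar> \<le> r"
  shows "supnorm d I z \<le> r"
  using assms by (auto simp: supnorm_def)

text \<open>Cutting the interval off at 0 and 1 leaves positive length even when \<open>t\<close> is
  an endpoint.\<close>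

lemma emeasure_interval_pos:
  fixes t r :: real
  assumes "t \<in> {0..1}" "0 < r"
  shows "emeasure (restrict_space lborel {0..1}) ({0..1} \<inter> {t - r..t + r}) \<noteq> 0"
proof -
  have eq: "{0..1} \<inter> {t - r..t + r} = {max 0 (t - r)..min 1 (t + r)}"
    by auto
  have "max 0 (t - r) < min 1 (t + r)"
    using assms by auto
  then show ?thesis
    by (subst emeasure_restrict_space) (auto simp: eq)
qed

text \<open>The closed sup-norm ball around \<open>x\<close> inside the cube is a finite product of
  intervals of positive length, so it is not a null set and must meet every set of full measure.
  With continuity, this turns almost sure bounds into pointwise ones.\<close>

lemma AE_cube_imp_exists_close:
  assumes "finite J" and x: "x \<in> space (cube d J)" and "0 < r"
    and Q: "AE y in cube d J. Q y"
  obtains y where "y \<in> space (cube d J)" "Q y" "supdist d J x y \<le> r"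
proof -
  define S where "S k i = {0..1} \<inter> {x k i - r..x k i + r}" for k i
  define B where "B = (\<Pi>\<^sub>E k\<in>J. \<Pi>\<^sub>E i\<in>{..<d k}. S k i)"
  \<comment> \<open>A cube is a product of products: \<open>U\<close> gives the product formula for
    the coordinates within one component, \<open>C\<close> the one for the components.\<close>
  interpret U: product_prob_space "\<lambda>_::nat. restrict_space lborel {0..1::real}" UNIV
    by (simp add: product_prob_space_def product_prob_space_axioms_def product_sigma_finite_def
        prob_space_unit_interval prob_space_imp_sigma_finite)
  have pU: "prob_space (\<Pi>\<^sub>M i\<in>{..<d k}. restrict_space lborel {0..1::real})" for k
    by (intro prob_space_PiM prob_space_unit_interval)
  interpret C: product_prob_space "\<lambda>k. \<Pi>\<^sub>M i\<in>{..<d k}. restrict_space lborel {0..1::real}" UNIV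
    by (simp add: product_prob_space_def product_prob_space_axioms_def product_sigma_finite_def
        pU prob_space_imp_sigma_finite)
  have S: "S k i \<in> sets (restrict_space lborel {0..1})" for k i
    unfolding S_def by (auto simp: sets_restrict_space)
  then have box: "(\<Pi>\<^sub>E i\<in>{..<d k}. S k i) \<in> sets (\<Pi>\<^sub>M i\<in>{..<d k}. restrict_space lborel {0..1})" for k
    by (intro sets_PiM_I_finite) auto
  have "emeasure (cube d J) B = (\<Prod>k\<in>J. \<Prod>i<d k. emeasure (restrict_space lborel {0..1}) (S k i))"
    unfolding B_def cube_def
    by (simp add: C.emeasure_PiM[OF \<open>finite J\<close> box] U.emeasure_PiM[OF finite_lessThan S])
  moreover have "x k i \<in> {0..1}" if "k \<in> J" "i < d k" for k i
    using x that unfolding space_cube by (metis PiE_mem lessThan_iff)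
  ultimately have pos: "emeasure (cube d J) B \<noteq> 0"
    using \<open>finite J\<close> emeasure_interval_pos[OF _ \<open>0 < r\<close>] by (auto simp: S_def)
  have "B \<in> sets (cube d J)"
    unfolding B_def cube_def by (intro sets_PiM_I_finite[OF \<open>finite J\<close>] box)
  then have "\<not> (AE y in cube d J. y \<notin> B)"
    using pos by (subst AE_iff_measurable[OF _ refl]) (auto dest: sets.sets_into_space
        simp: AE_iff_measurable Int_absorb1 Collect_conj_eq)
  \<comment> \<open>If \<open>Q\<close> failed throughout \<open>B\<close>, then almost every point
    would lie outside \<open>B\<close>.\<close>
  then obtain y where y: "y \<in> B" "y \<in> space (cube d J)" "Q y"
    using Q by (metis (mono_tags, lifting) AE_I2 AE_mp)
  have "\<bar>x k i - y k i\<bar> \<le> r" if "k \<in> J" "i < d k" for k i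
  proof -
    have "y k i \<in> S k i"
      using y(1) that unfolding B_def by (metis PiE_mem lessThan_iff)
    then show ?thesis by (auto simp: S_def)
  qed
  then have "supdist d J x y \<le> r"
    unfolding supdist_def using \<open>finite J\<close> \<open>0 < r\<close> by (intro supnorm_le) auto
  with y that show thesis by blast
qed

section \<open>The conditional kernel given by a joint density\<close>

text \<open>Both halves of the theorem rest on this lemma: the first is an instance of it, the
  second applies it to each pair of index sets coming from the graph.\<close>

lemma TV_lipschitz_kernel_of_density:
  fixes K :: nat and a M :: real
  assumes \<mu>: "\<mu> \<in> space (prob_algebra (cube d {1..K}))"
    and "0 < a" "0 \<le> M"
    and IJ: "I \<subseteq> {1..K}" "J \<subseteq> {1..K}"
    and f: "is_density (cube d I \<Otimes>\<^sub>M cube d J) (marginal2 d \<mu> I J) f"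
    and fJ: "is_density (cube d J) (marginal d \<mu> J) f\<^sub>J"
    and ge: "AE x in cube d J. a \<le> f\<^sub>J x"
    and lip: "L1_lipschitz d I J M f"
  shows "TV_lipschitz_kernel d \<mu> I J (M / a)"
proof -
  let ?N = "cube d I" and ?P = "cube d J"
  have "finite J" using IJ(2) finite_subset by blast
  interpret N: prob_space ?N by (rule prob_space_cube)
  interpret P: prob_space ?P by (rule prob_space_cube)
  interpret NP: pair_sigma_finite ?N ?P ..
  have f_meas [measurable]: "f \<in> borel_measurable (?N \<Otimes>\<^sub>M ?P)"
    and f_nonneg: "\<And>z x. z \<in> space ?N \<Longrightarrow> x \<in> space ?P \<Longrightarrow> 0 \<le> f (z, x)"
    and f_eq: "marginal2 d \<mu> I J = density (?N \<Otimes>\<^sub>M ?P) (\<lambda>w. ennreal (f w))"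
    using f by (auto simp: is_density_def space_pair_measure)
  have [measurable]: "f\<^sub>J \<in> borel_measurable ?P"
    and fJ_nonneg: "\<And>x. x \<in> space ?P \<Longrightarrow> 0 \<le> f\<^sub>J x"
    and fJ_eq: "marginal d \<mu> J = density ?P (\<lambda>x. ennreal (f\<^sub>J x))"
    using fJ by (auto simp: is_density_def)
  have f_int: "integrable ?N (\<lambda>z. f (z, x))" if "x \<in> space ?P" for x
    using lip that by (auto simp: L1_lipschitz_def)
  have f_lip: "(\<integral>z. \<bar>f (z, x) - f (z, y)\<bar> \<partial>?N) \<le> M * supdist d J x y"
    if "x \<in> space ?P" "y \<in> space ?P" for x y
    using lip that by (auto simp: L1_lipschitz_def)

  \<comment> \<open>While \<open>f\<^sub>J\<close> is an arbitrary version, \<open>g\<close> is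
    computed from the Lipschitz version \<open>f\<close> at every point. It is finite everywhere
    because every section of \<open>f\<close> is integrable.\<close>
  define g where "g x = (\<integral>z. f (z, x) \<partial>?N)" for x
  have [measurable]: "g \<in> borel_measurable ?P"
    unfolding g_def by measurable
  have nn_g: "(\<integral>\<^sup>+z. ennreal (f (z, x)) \<partial>?N) = ennreal (g x)" if "x \<in> space ?P" for x
    unfolding g_def using f_int f_nonneg that by (intro nn_integral_eq_integral) auto

  have sets_\<mu>: "sets \<mu> = sets (cube d {1..K})"
    using \<mu> by (auto simp: space_prob_algebra)
  have [measurable]: "(\<lambda>x. restrict x I) \<in> \<mu> \<rightarrow>\<^sub>M ?N" "(\<lambda>x. restrict x J) \<in> \<mu> \<rightarrow>\<^sub>M ?P"
    unfolding measurable_cong_sets[OF sets_\<mu> refl]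
    using IJ by (simp_all only: measurable_restrict_cube)
  \<comment> \<open>The marginal is the second projection of the joint law. Integrating out
    \<open>z\<close> by Tonelli shows that \<open>g\<close> is a density of it, so \<open>g\<close>
    and \<open>f\<^sub>J\<close> agree almost everywhere by uniqueness of densities.\<close>
  have "marginal d \<mu> J = distr (marginal2 d \<mu> I J) ?P snd"
    unfolding marginal_def marginal2_def by (subst distr_distr) (auto simp: comp_def)
  also have "\<dots> = density ?P (\<lambda>x. ennreal (g x))"
  proof (rule measure_eqI)
    fix B assume "B \<in> sets (distr (marginal2 d \<mu> I J) ?P snd)"
    then have [measurable]: "B \<in> sets ?P" by simp
    have "emeasure (distr (marginal2 d \<mu> I J) ?P snd) B
        = (\<integral>\<^sup>+w. ennreal (f w) * indicator B (snd w) \<partial>(?N \<Otimes>\<^sub>M ?P))"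
      unfolding f_eq
      by (subst emeasure_distr, simp, simp, subst emeasure_density)
         (auto intro!: nn_integral_cong split: split_indicator simp: space_pair_measure)
    also have "\<dots> = (\<integral>\<^sup>+x. \<integral>\<^sup>+z. ennreal (f (z, x)) * indicator B x \<partial>?N \<partial>?P)"
      by (subst NP.nn_integral_snd[symmetric]) (auto simp: case_prod_beta')
    also have "\<dots> = (\<integral>\<^sup>+x. ennreal (g x) * indicator B x \<partial>?P)"
      by (intro nn_integral_cong) (simp add: nn_integral_multc nn_g)
    also have "\<dots> = emeasure (density ?P (\<lambda>x. ennreal (g x))) B"
      by (simp add: emeasure_density)
    finally show "emeasure (distr (marginal2 d \<mu> I J) ?P snd) B
      = emeasure (density ?P (\<lambda>x. ennreal (g x))) B" .
  qed simp
  finally have "density ?P (\<lambda>x. ennreal (f\<^sub>J x)) = density ?P (\<lambda>x. ennreal (g x))"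
    using fJ_eq by simp
  then have ennreal_eq: "AE x in ?P. ennreal (f\<^sub>J x) = ennreal (g x)"
    by (subst (asm) P.density_unique_iff) auto
  \<comment> \<open>\<open>ennreal\<close> sends negative reals to 0, so the equality passes back to
    the reals only with both sides known to be nonnegative.\<close>
  have g_nonneg: "0 \<le> g x" if "x \<in> space ?P" for x
    unfolding g_def using f_nonneg that by (intro integral_nonneg_AE AE_I2) auto
  have fJ_g: "AE x in ?P. f\<^sub>J x = g x"
    using ennreal_eq AE_space by eventually_elim (simp add: fJ_nonneg g_nonneg)
  have g_lip: "\<bar>g x - g y\<bar> \<le> M * supdist d J x y" if "x \<in> space ?P" "y \<in> space ?P" for x y
    unfolding g_def using abs_integral_diff_le[OF f_int f_int] f_lip that by (meson order_trans)
  have g_ge: "a \<le> g x" if x: "x \<in> space ?P" for x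
  proof (rule ccontr)
    assume "\<not> a \<le> g x"
    \<comment> \<open>The gap \<open>a - g x\<close> is divided by \<open>M + 1\<close> rather than
      \<open>M\<close>, so that \<open>M * r\<close> stays strictly below the gap, also for
      \<open>M = 0\<close>.\<close>
    define r where "r = (a - g x) / (M + 1)"
    have "0 < r" using \<open>\<not> a \<le> g x\<close> \<open>0 \<le> M\<close> by (simp add: r_def)
    have "AE y in ?P. a \<le> g y" using ge fJ_g by eventually_elim simp
    with \<open>finite J\<close> x \<open>0 < r\<close> obtain y
      where y: "y \<in> space ?P" "a \<le> g y" "supdist d J x y \<le> r"
      by (rule AE_cube_imp_exists_close)
    have "a - g x \<le> \<bar>g x - g y\<bar>" using y by simp
    also have "\<dots> \<le> M * supdist d J x y" by (rule g_lip[OF x y(1)])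
    also have "\<dots> \<le> M * r" using y \<open>0 \<le> M\<close> by (intro mult_left_mono)
    also have "\<dots> < (M + 1) * r" using \<open>0 < r\<close> by (simp add: algebra_simps)
    also have "\<dots> = a - g x" using \<open>0 \<le> M\<close> by (simp add: r_def)
    finally show False by simp
  qed
  have g_pos: "0 < g x" if "x \<in> space ?P" for x
    using g_ge[OF that] \<open>0 < a\<close> by simp

  define \<kappa> where "\<kappa> x = density ?N (\<lambda>z. ennreal (f (z, x) / g x))" for x
  have \<kappa>_meas: "emeasure (\<kappa> x) A = (\<integral>\<^sup>+z. ennreal (f (z, x) / g x) * indicator A z \<partial>?N)"
    if [measurable]: "x \<in> space ?P" "A \<in> sets ?N" for x A
    unfolding \<kappa>_def by (intro emeasure_density) measurable
  \<comment> \<open>This form without a quotient serves twice: with \<open>A\<close> the whole space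
    it gives total mass 1, and integrated over \<open>B\<close> it gives the disintegration of the
    joint law.\<close>
  have \<kappa>_g: "ennreal (g x) * emeasure (\<kappa> x) A = (\<integral>\<^sup>+z. ennreal (f (z, x)) * indicator A z \<partial>?N)"
    if [measurable]: "x \<in> space ?P" "A \<in> sets ?N" for x A
  proof -
    have "ennreal (g x) * emeasure (\<kappa> x) A
        = (\<integral>\<^sup>+z. ennreal (g x) * (ennreal (f (z, x) / g x) * indicator A z) \<partial>?N)"
      unfolding \<kappa>_meas[OF that] by (intro nn_integral_cmult[symmetric]) measurable
    also have "\<dots> = (\<integral>\<^sup>+z. ennreal (f (z, x)) * indicator A z \<partial>?N)"
      using g_pos[OF that(1)] f_nonneg[OF _ that(1)]
      by (intro nn_integral_cong)
         (auto simp: mult.assoc[symmetric] ennreal_mult''[symmetric])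
    finally show ?thesis .
  qed
  have \<kappa>_prob: "prob_space (\<kappa> x)" if x: "x \<in> space ?P" for x
  proof (rule prob_spaceI)
    have "ennreal (g x) * emeasure (\<kappa> x) (space ?N) = ennreal (g x) * 1"
      using \<kappa>_g[OF x sets.top] nn_g[OF x]
      by (simp add: cong: nn_integral_cong)
    then show "emeasure (\<kappa> x) (space (\<kappa> x)) = 1"
      using g_pos[OF x] by (subst (asm) ennreal_mult_cancel_left) (auto simp: \<kappa>_def)
  qed
  have \<kappa>_measurable: "\<kappa> \<in> ?P \<rightarrow>\<^sub>M prob_algebra ?N"
  proof (rule measurable_prob_algebraI[OF \<kappa>_prob], assumption, rule measurable_subprob_algebra)
    fix A assume [measurable]: "A \<in> sets ?N"
    have "(\<lambda>x. \<integral>\<^sup>+z. ennreal (f (z, x) / g x) * indicator A z \<partial>?N) \<in> borel_measurable ?P"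
      by measurable
    then show "(\<lambda>x. emeasure (\<kappa> x) A) \<in> borel_measurable ?P"
      by (subst measurable_cong[OF \<kappa>_meas]) auto
  qed (simp_all add: \<kappa>_prob prob_space_imp_subprob_space, simp add: \<kappa>_def)
  have \<kappa>_marginal2: "emeasure (marginal2 d \<mu> I J) (A \<times> B)
      = (\<integral>\<^sup>+x\<in>B. emeasure (\<kappa> x) A \<partial>marginal d \<mu> J)"
    if [measurable]: "A \<in> sets ?N" "B \<in> sets ?P" for A B
  proof -
    have [measurable]: "(\<lambda>x. emeasure (\<kappa> x) A) \<in> borel_measurable ?P"
      by (rule measurable_compose[OF measurable_prob_algebraD[OF \<kappa>_measurable]
          measurable_emeasure_subprob_algebra[OF that(1)]])
    have "emeasure (marginal2 d \<mu> I J) (A \<times> B)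
        = (\<integral>\<^sup>+w. ennreal (f w) * indicator (A \<times> B) w \<partial>(?N \<Otimes>\<^sub>M ?P))"
      unfolding f_eq by (intro emeasure_density) measurable
    also have "\<dots> = (\<integral>\<^sup>+x. \<integral>\<^sup>+z. ennreal (f (z, x)) * indicator (A \<times> B) (z, x) \<partial>?N \<partial>?P)"
      by (subst NP.nn_integral_snd[symmetric]) (auto simp: case_prod_beta')
    also have "\<dots> = (\<integral>\<^sup>+x. ennreal (g x) * (emeasure (\<kappa> x) A * indicator B x) \<partial>?P)"
    proof (rule nn_integral_cong)
      fix x assume [measurable]: "x \<in> space ?P"
      have "(\<integral>\<^sup>+z. ennreal (f (z, x)) * indicator (A \<times> B) (z, x) \<partial>?N)
          = (\<integral>\<^sup>+z. ennreal (f (z, x)) * indicator A z * indicator B x \<partial>?N)"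
        by (simp add: indicator_times mult.assoc)
      also have "\<dots> = (\<integral>\<^sup>+z. ennreal (f (z, x)) * indicator A z \<partial>?N) * indicator B x"
        by (rule nn_integral_multc) measurable
      also have "\<dots> = ennreal (g x) * (emeasure (\<kappa> x) A * indicator B x)"
        using \<kappa>_g[OF \<open>x \<in> space ?P\<close> that(1)] by (simp add: mult.assoc[symmetric])
      finally show "(\<integral>\<^sup>+z. ennreal (f (z, x)) * indicator (A \<times> B) (z, x) \<partial>?N)
          = ennreal (g x) * (emeasure (\<kappa> x) A * indicator B x)" .
    qed
    \<comment> \<open>The marginal is expressed through \<open>f\<^sub>J\<close>, so
      \<open>g\<close> is exchanged for it outside a null set.\<close>
    also have "\<dots> = (\<integral>\<^sup>+x. ennreal (f\<^sub>J x) * (emeasure (\<kappa> x) A * indicator B x) \<partial>?P)"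
      using fJ_g by (intro nn_integral_cong_AE) auto
    also have "\<dots> = (\<integral>\<^sup>+x\<in>B. emeasure (\<kappa> x) A \<partial>marginal d \<mu> J)"
      unfolding fJ_eq by (intro nn_integral_density[symmetric]) measurable
    finally show ?thesis .
  qed
  have \<kappa>_TV: "TV (\<kappa> x) (\<kappa> y) \<le> M / a * supdist d J x y"
    if x: "x \<in> space ?P" and y: "y \<in> space ?P" for x y
  proof -
    have "TV (\<kappa> x) (\<kappa> y) \<le> (\<integral>z. \<bar>f (z, x) / g x - f (z, y) / g y\<bar> \<partial>?N) / 2"
      unfolding \<kappa>_def using x y f_nonneg f_int g_nonneg
      by (intro TV_density_le) (auto intro!: divide_nonneg_nonneg)
    \<comment> \<open>The section at \<open>x\<close> plays the role of \<open>u\<close> and the one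
      at \<open>y\<close> that of \<open>v\<close>. The factor 2 lost by normalising cancels the 1/2
      of the total variation bound, which leaves exactly \<open>M / a\<close>.\<close>
    also have "\<dots> \<le> (2 * (\<integral>z. \<bar>f (z, x) - f (z, y)\<bar> \<partial>?N) / a) / 2"
      using L1_dist_normalized_le[OF f_int[OF x] f_int[OF y] f_nonneg[OF _ y] \<open>0 < a\<close>,
          folded g_def, OF _ g_ge[OF x] g_pos[OF y]]
      by (intro divide_right_mono) auto
    also have "\<dots> \<le> M * supdist d J x y / a"
      using f_lip[OF x y] \<open>0 < a\<close> by (simp add: divide_right_mono)
    finally show ?thesis by simp
  qed
  show ?thesis
    unfolding TV_lipschitz_kernel_def is_cond_distr_def
    using \<kappa>_measurable \<kappa>_marginal2 \<kappa>_TV by (intro exI[of _ \<kappa>] conjI ballI)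
qed

section \<open>From index pairs to the condition on the graph\<close>

lemma dag_pairs_subset:
  assumes "sorted_dag K E" "k \<in> {2..K}" "(I, J) \<in> dag_pairs E k"
  shows "I \<subseteq> {1..K}" "J \<subseteq> {1..K}"
proof -
  have "pa E k \<subseteq> {1..K}" "pre E k \<subseteq> {1..K}" "{k} \<subseteq> {1..K}"
    using assms(1,2) by (auto simp: sorted_dag_def pa_def pre_def)
  then show "I \<subseteq> {1..K}" "J \<subseteq> {1..K}"
    using assms(3) by (auto simp: dag_pairs_def)
qed

theorem corollary3p7:
  fixes K :: nat and d :: "nat \<Rightarrow> nat" and \<mu> :: "(nat \<Rightarrow> nat \<Rightarrow> real) measure" and a M :: real
  assumes "\<mu> \<in> space (prob_algebra (cube d {1..K}))"
    and "a > 0" and "M \<ge> 0"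
  shows "(\<forall>I J f f\<^sub>J.
            I \<subseteq> {1..K} \<longrightarrow> J \<subseteq> {1..K} \<longrightarrow> I \<inter> J = {} \<longrightarrow> I \<noteq> {} \<longrightarrow> J \<noteq> {} \<longrightarrow>
            is_density (cube d I \<Otimes>\<^sub>M cube d J) (marginal2 d \<mu> I J) f \<longrightarrow>
            is_density (cube d J) (marginal d \<mu> J) f\<^sub>J \<longrightarrow>
            (AE x in cube d J. a \<le> f\<^sub>J x) \<longrightarrow>
            L1_lipschitz d I J M f \<longrightarrow>
            TV_lipschitz_kernel d \<mu> I J (M / a)) \<and>
         (\<forall>E. sorted_dag K E \<longrightarrow> \<mu> \<in> P_G d K E \<longrightarrow>
            (\<forall>k\<in>{2..K}. \<forall>(I, J)\<in>dag_pairs E k. lipschitz_density d \<mu> I J a M) \<longrightarrow>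
            TV_lipschitz_condition d K E \<mu> (M / a))"
proof (intro conjI allI impI)
  fix I J f f\<^sub>J
  assume "I \<subseteq> {1..K}" "J \<subseteq> {1..K}"
    "is_density (cube d I \<Otimes>\<^sub>M cube d J) (marginal2 d \<mu> I J) f"
    "is_density (cube d J) (marginal d \<mu> J) f\<^sub>J"
    "AE x in cube d J. a \<le> f\<^sub>J x" "L1_lipschitz d I J M f"
  with assms show "TV_lipschitz_kernel d \<mu> I J (M / a)"
    by (rule TV_lipschitz_kernel_of_density)
next
  fix E
  assume E: "sorted_dag K E"
    and dens: "\<forall>k\<in>{2..K}. \<forall>(I, J)\<in>dag_pairs E k. lipschitz_density d \<mu> I J a M"
  have "TV_lipschitz_kernel d \<mu> I J (M / a)"
    if k: "k \<in> {2..K}" "(I, J) \<in> dag_pairs E k" for k I J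
  proof -
    \<comment> \<open>Each pair comes with its own versions of the densities; only \<open>a\<close>
      and \<open>M\<close> are common to all pairs.\<close>
    from dens k have "lipschitz_density d \<mu> I J a M" by auto
    then show ?thesis
      unfolding lipschitz_density_def
      using TV_lipschitz_kernel_of_density[OF assms dag_pairs_subset[OF E k]] by blast
  qed
  then show "TV_lipschitz_condition d K E \<mu> (M / a)"
    by (auto simp: TV_lipschitz_condition_def)
qed

end
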